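(* Let $B\le \mathrm{Aff}(\mathbb{R})$ be a finitely generated non-abelian group with standard inclusion $j\colon B\to\mathrm{Homeo}_0(\mathbb{R})$, let $G=\mathbb{Z}\wr B$ with quotient projection $\pi_B\colon G\to B$, let $\psi\colon G\to\mathrm{Homeo}_0(\mathbb{R})$ be the action described in the context (associated with a point $\xi_0\in\mathbb{R}$ having free $j$-orbit), let $t\in B$ be such that $j(t)$ is a positive translation, let $\tau$ be the automorphism of $G$ given by $\tau(f,b)=(\rho_t(f),b)$, and set $\psi_n=\psi\circ\tau^n$ for $n\in\mathbb{N}$. Then there exists a sequence of homeomorphisms $(s_n)\subset\mathrm{Homeo}_0(\mathbb{R})$ such that the sequence of conjugate actions $\varphi_n(g)=s_n\psi_n(g)s_n^{-1}$ has a subsequence which converges to a limit $\varphi\in\mathrm{Hom}_{\mathrm{irr}}(G,\mathrm{Homeo}_0(\mathbb{R}))$, which is positively conjugate to the non-abelian affine action $j\circ\pi_B$.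
   Context: $\mathrm{Homeo}_0(\mathbb{R})$ is the group of orientation-preserving homeomorphisms of $\mathbb{R}$ with the compact-open topology. $\mathrm{Aff}(\mathbb{R})=\{x\mapsto ax+b: a>0,\ b\in\mathbb{R}\}$. An action $G\to\mathrm{Homeo}_0(\mathbb{R})$ is irreducible if it has no global fixed point; $\mathrm{Hom}_{\mathrm{irr}}(G,\mathrm{Homeo}_0(\mathbb{R}))$ is the space of irreducible actions with the topology of pointwise convergence. Two actions are positively conjugate if they are intertwined by an orientation-preserving homeomorphism of $\mathbb{R}$. Let $L=\bigoplus_B\mathbb{Z}$ be the group of finitely supported functions $f\colon B\to\mathbb{Z}$. Let $\lambda,\rho\colon B\to\mathrm{Aut}(L)$ be the commuting left- and right-regular actions, $\lambda_b(f)(k)=f(b^{-1}k)$ and $\rho_b(f)(k)=f(kb)$. The wreath product $G=\mathbb{Z}\wr B=L\rtimes B$ is the semi-direct product with respect to $\lambda$. Since $\rho_t$ commutes with $\lambda$, $\tau(f,b)=(\rho_t(f),b)$ is an automorphism of $G$. Construction of $\psi$: choose $\xi_0\in\mathbb{R}$ with a free orbit under $j$ (trivial stabilizer), and let $<_B$ be the left-invariant order on $B$ given by $b_1<_Bb_2$ iff $j(b_1)(\xi_0)<j(b_2)(\xi_0)$. Define a total order $\prec$ on $L$ by $f_1\prec f_2$ iff $f_1(b_* )<f_2(b_* )$, where $b_*=\max_{<_B}\{b: f_1(b)\ne f_2(b)\}$. Let $\alpha\colon G\to\mathrm{Aut}(L,\prec)$ be the order-preserving action $\alpha(r,b)(f)=r+\lambda_b(f)$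 for $(r,b)\in L\rtimes B$, $f\in L$. Then $\psi\colon G\to\mathrm{Homeo}_0(\mathbb{R})$ is the dynamical realization of $\alpha$. Dynamical realization: given an order-preserving non-trivial action $\alpha$ of a group $G$ on a countable densely ordered set $(\Omega,<)$ with neither maximum nor minimum, fix an order-preserving bijection $\iota\colon\Omega\to\mathbb{Q}$; a dynamical realization of $\alpha$ is an irreducible action $\bar\alpha\colon G\to\mathrm{Homeo}_0(\mathbb{R})$ with $\bar\alpha(g)(\iota(\omega))=\iota(\alpha(g)(\omega))$ for all $g\in G,\ \omega\in\Omega$. It exists and is unique up to positive conjugacy. *)

theory Defs
  imports "HOL-Analysis.Analysis" "HOL-Algebra.Generated_Groups"
begin

section \<open>Homeomorphisms of the line and their actions\<close>

definition Homeo0 :: "(real \<Rightarrow> real) monoid" where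
  "Homeo0 = \<lparr>carrier = {f. strict_mono f \<and> (\<exists>g. homeomorphism UNIV UNIV f g)},
             mult = (\<circ>), one = id\<rparr>"

definition Aff :: "(real \<Rightarrow> real) monoid" where
  "Aff = Homeo0\<lparr>carrier := {f. \<exists>a b. a > 0 \<and> f = (\<lambda>x. a * x + b)}\<rparr>"

definition finitely_generated_group :: "('a, 'm) monoid_scheme \<Rightarrow> bool" where
  "finitely_generated_group G \<longleftrightarrow>
     group G \<and> (\<exists>S. finite S \<and> S \<subseteq> carrier G \<and> generate G S = carrier G)"

definition compact_open_Homeo0 :: "(real \<Rightarrow> real) topology" where
  "compact_open_Homeo0 =
     topology_generated_by {{f \<in> carrier Homeo0. f ` K \<subseteq> U} | K U. compact K \<and> open U}"

text \<open>Actions are homomorphisms, taken to be \<^const>\<open>undefined\<close> outside the carrier, so that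
  the space of actions is a subset of the product of copies of \<^const>\<open>Homeo0\<close> indexed by
  the carrier.\<close>

definition Hom_irr :: "('g, 'm) monoid_scheme \<Rightarrow> ('g \<Rightarrow> real \<Rightarrow> real) set" where
  "Hom_irr G = {\<phi> \<in> hom G Homeo0. \<phi> \<in> extensional (carrier G) \<and>
                 \<not> (\<exists>x. \<forall>g\<in>carrier G. \<phi> g x = x)}"

definition Hom_irr_topology :: "('g, 'm) monoid_scheme \<Rightarrow> ('g \<Rightarrow> real \<Rightarrow> real) topology" where
  "Hom_irr_topology G =
     subtopology (product_topology (\<lambda>_. compact_open_Homeo0) (carrier G)) (Hom_irr G)"

definition conj_action ::
  "('g, 'm) monoid_scheme \<Rightarrow> (real \<Rightarrow> real) \<Rightarrow> ('g \<Rightarrow> real \<Rightarrow> real) \<Rightarrow> ('g \<Rightarrow> real \<Rightarrow> real)" where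
  "conj_action G s \<phi> =
     (\<lambda>g\<in>carrier G. s \<otimes>\<^bsub>Homeo0\<^esub> \<phi> g \<otimes>\<^bsub>Homeo0\<^esub> inv\<^bsub>Homeo0\<^esub> s)"

definition positively_conjugate ::
  "('g, 'm) monoid_scheme \<Rightarrow> ('g \<Rightarrow> real \<Rightarrow> real) \<Rightarrow> ('g \<Rightarrow> real \<Rightarrow> real) \<Rightarrow> bool" where
  "positively_conjugate G \<phi>1 \<phi>2 \<longleftrightarrow>
     (\<exists>h\<in>carrier Homeo0. \<forall>g\<in>carrier G. h \<circ> \<phi>1 g = \<phi>2 g \<circ> h)"

text \<open>The ordered set is the set \<open>\<Omega>\<close> with the strict order \<open>lt\<close>, on which \<open>G\<close> acts by
  \<open>\<alpha>\<close>. The existence of an order isomorphism \<open>\<iota>\<close> onto the rationals amounts, by Cantor's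
  theorem, to \<open>\<Omega>\<close> being nonempty, countable, densely ordered and without maximum and
  minimum. A dynamical realization is only unique up to positive conjugacy, whence a
  predicate.\<close>

definition dynamical_realization ::
  "('g, 'm) monoid_scheme \<Rightarrow> 'w set \<Rightarrow> ('w \<Rightarrow> 'w \<Rightarrow> bool) \<Rightarrow> ('g \<Rightarrow> 'w \<Rightarrow> 'w) \<Rightarrow>
   ('g \<Rightarrow> real \<Rightarrow> real) \<Rightarrow> bool" where
  "dynamical_realization G \<Omega> lt \<alpha> \<psi> \<longleftrightarrow>
     \<psi> \<in> Hom_irr G \<and>
     (\<exists>\<iota>. bij_betw \<iota> \<Omega> (\<rat> :: real set) \<and>
          (\<forall>x\<in>\<Omega>. \<forall>y\<in>\<Omega>. lt x y \<longleftrightarrow> \<iota> x < \<iota> y) \<and>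
          (\<forall>g\<in>carrier G. \<forall>x\<in>\<Omega>. \<psi> g (\<iota> x) = \<iota> (\<alpha> g x)))"

section \<open>The wreath product of the integers with a group\<close>

text \<open>A function on the group \<open>B\<close> is extended by \<open>0\<close> to the whole type.\<close>

definition lamps :: "('b, 'm) monoid_scheme \<Rightarrow> ('b \<Rightarrow> int) set" where
  "lamps B = {f. (\<forall>k. k \<notin> carrier B \<longrightarrow> f k = 0) \<and> finite {k \<in> carrier B. f k \<noteq> 0}}"

definition left_reg :: "('b, 'm) monoid_scheme \<Rightarrow> 'b \<Rightarrow> ('b \<Rightarrow> int) \<Rightarrow> ('b \<Rightarrow> int)" where
  "left_reg B b f = (\<lambda>k. if k \<in> carrier B then f (inv\<^bsub>B\<^esub> b \<otimes>\<^bsub>B\<^esub> k) else 0)"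

definition right_reg :: "('b, 'm) monoid_scheme \<Rightarrow> 'b \<Rightarrow> ('b \<Rightarrow> int) \<Rightarrow> ('b \<Rightarrow> int)" where
  "right_reg B b f = (\<lambda>k. if k \<in> carrier B then f (k \<otimes>\<^bsub>B\<^esub> b) else 0)"

definition wreath :: "('b, 'm) monoid_scheme \<Rightarrow> (('b \<Rightarrow> int) \<times> 'b) monoid" where
  "wreath B = \<lparr>carrier = lamps B \<times> carrier B,
     mult = (\<lambda>(f, b) (g, c). (\<lambda>k. f k + left_reg B b g k, b \<otimes>\<^bsub>B\<^esub> c)),
     one = (\<lambda>_. 0, \<one>\<^bsub>B\<^esub>)\<rparr>"

definition wreath_aut :: "('b, 'm) monoid_scheme \<Rightarrow> 'b \<Rightarrow> ('b \<Rightarrow> int) \<times> 'b \<Rightarrow> ('b \<Rightarrow> int) \<times> 'b" where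
  "wreath_aut B t = (\<lambda>(f, b). (right_reg B t f, b))"

definition lamps_action ::
  "('b, 'm) monoid_scheme \<Rightarrow> ('b \<Rightarrow> int) \<times> 'b \<Rightarrow> ('b \<Rightarrow> int) \<Rightarrow> ('b \<Rightarrow> int)" where
  "lamps_action B = (\<lambda>(r, b) f. \<lambda>k. r k + left_reg B b f k)"

definition orbit_less :: "('b \<Rightarrow> real \<Rightarrow> real) \<Rightarrow> real \<Rightarrow> 'b \<Rightarrow> 'b \<Rightarrow> bool" where
  "orbit_less j \<xi> b1 b2 \<longleftrightarrow> j b1 \<xi> < j b2 \<xi>"

text \<open>Below, \<open>m\<close> is the maximum, for \<open>lessB\<close>, of the set of points where \<open>f1\<close> and \<open>f2\<close>
  differ.\<close>

definition lamps_less ::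
  "('b, 'm) monoid_scheme \<Rightarrow> ('b \<Rightarrow> 'b \<Rightarrow> bool) \<Rightarrow> ('b \<Rightarrow> int) \<Rightarrow> ('b \<Rightarrow> int) \<Rightarrow> bool" where
  "lamps_less B lessB f1 f2 \<longleftrightarrow>
     (\<exists>m\<in>{b \<in> carrier B. f1 b \<noteq> f2 b}.
        (\<forall>b\<in>{b \<in> carrier B. f1 b \<noteq> f2 b}. b = m \<or> lessB b m) \<and> f1 m < f2 m)"

end

theory Submission
  imports Defs
begin

text \<open>Measure a positive lamp configuration by the point \<open>b \<xi>\<close> of the line at which its
  \<open><\<^sub>B\<close>-largest lit lamp \<open>b\<close> stands. A larger configuration has a larger or equal measure, so the
  measure extends to a nondecreasing map \<open>P\<close> to the line from the half-line of the points that
  lie above the empty configuration \<open>0\<close>. The map \<open>P\<close> collapses intervals (one lamp and the same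
  lamp lit twice have the same measure), but it is continuous and onto, since \<open>B\<close> contains a
  translation and a contraction, so that the orbit of \<open>\<xi>\<close> is dense (\<open>dense_orbit\<close>). It
  intertwines the action of \<open>B\<close> with the affine one, because \<open>b\<close> moves the top lamp \<open>c\<close> to \<open>bc\<close>. It
  is also invariant under adding a configuration \<open>r\<close>, as long as one stays at points \<open>x\<close> with
  \<open>P x\<close> above all the lamps of \<open>r\<close>, because then the top lamp is not touched.

  The automorphism \<open>\<tau>\<^sup>n\<close> leaves \<open>B\<close> alone and moves the lamps of \<open>r\<close> from \<open>k\<close> to
  \<open>k t\<^sup>-\<^sup>n\<close>. The point \<open>k t\<^sup>-\<^sup>n \<xi>\<close> tends to minus infinity, as \<open>k\<close> preserves the orientation
  (\<open>right_reg_translation_vanishes\<close>). Hence, on any region where \<open>P\<close> is bounded below, for large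
  \<open>n\<close> the map \<open>P\<close> semiconjugates \<open>\<psi> (\<tau>\<^sup>n (r, b))\<close> to the affine map \<open>b\<close> itself
  (\<open>level_equivariant\<close>).

  It remains to turn semiconjugacy into convergence of conjugates. Choose homeomorphisms \<open>s\<^sub>n\<close>
  that are uniformly \<open>1/(n+1)\<close>-close to \<open>P\<close> where \<open>P > -n\<close>, and send the rest of the line,
  including the whole negative side of \<open>0\<close>, far to the left (\<open>homeomorphism_near_level\<close>). Then
  \<open>s\<^sub>n \<psi> (\<tau>\<^sup>n (r, b)) s\<^sub>n\<^sup>-\<^sup>1\<close> converges to \<open>b\<close> uniformly on compact sets
  (\<open>conjugates_converge\<close>). The whole sequence converges, and its limit is equal to the affine
  action, not merely conjugate to it.\<close>

section \<open>Homeomorphisms of the line\<close>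

lemma carrier_Homeo0_iff:
  "f \<in> carrier Homeo0 \<longleftrightarrow> strict_mono f \<and> continuous_on UNIV f \<and> surj f"
proof
  assume "f \<in> carrier Homeo0"
  then show "strict_mono f \<and> continuous_on UNIV f \<and> surj f"
    by (auto simp: Homeo0_def homeomorphism_def)
next
  assume f: "strict_mono f \<and> continuous_on UNIV f \<and> surj f"
  then have "inj f"
    by (simp add: strict_mono_imp_inj_on)
  then obtain g where "homeomorphism UNIV UNIV f g"
    using f homeomorphism_into_1d[of UNIV f UNIV] by (auto simp: path_connected_UNIV)
  then show "f \<in> carrier Homeo0"
    using f by (auto simp: Homeo0_def)
qed

lemma mult_Homeo0 [simp]: "f \<otimes>\<^bsub>Homeo0\<^esub> g = f \<circ> g"
  by (simp add: Homeo0_def)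

lemma one_Homeo0 [simp]: "\<one>\<^bsub>Homeo0\<^esub> = id"
  by (simp add: Homeo0_def)

lemma group_Homeo0: "group Homeo0"
proof (rule groupI)
  fix f g assume "f \<in> carrier Homeo0" "g \<in> carrier Homeo0"
  then show "f \<otimes>\<^bsub>Homeo0\<^esub> g \<in> carrier Homeo0"
    unfolding carrier_Homeo0_iff mult_Homeo0
    using strict_mono_o comp_surj continuous_on_compose continuous_on_subset by (metis top_greatest)
next
  show "\<one>\<^bsub>Homeo0\<^esub> \<in> carrier Homeo0"
    by (auto simp: carrier_Homeo0_iff strict_mono_def)
next
  fix f assume f: "f \<in> carrier Homeo0"
  then obtain g where g: "homeomorphism UNIV UNIV f g" and mono: "strict_mono f"
    by (auto simp: Homeo0_def)
  have gf: "g (f x) = x" and fg: "f (g x) = x" for x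
    using g by (auto simp: homeomorphism_def)
  have "strict_mono g"
    by (metis fg mono strict_mono_def strict_mono_less)
  moreover have "homeomorphism UNIV UNIV g f"
    using g homeomorphism_sym by blast
  ultimately have "g \<in> carrier Homeo0"
    by (auto simp: Homeo0_def)
  moreover have "g \<otimes>\<^bsub>Homeo0\<^esub> f = \<one>\<^bsub>Homeo0\<^esub>"
    using gf by auto
  ultimately show "\<exists>g\<in>carrier Homeo0. g \<otimes>\<^bsub>Homeo0\<^esub> f = \<one>\<^bsub>Homeo0\<^esub>"
    by blast
qed (auto simp: o_assoc)

lemma conjugate_in_Homeo0:
  assumes "s \<in> carrier Homeo0" "f \<in> carrier Homeo0"
  shows "s \<otimes>\<^bsub>Homeo0\<^esub> f \<otimes>\<^bsub>Homeo0\<^esub> inv\<^bsub>Homeo0\<^esub> s \<in> carrier Homeo0"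
  using assms group.inv_closed[OF group_Homeo0] monoid.m_closed[OF group.is_monoid[OF group_Homeo0]]
  by blast

lemma inv_Homeo0_apply:
  assumes "s \<in> carrier Homeo0"
  shows "(inv\<^bsub>Homeo0\<^esub> s) (s x) = x" "s ((inv\<^bsub>Homeo0\<^esub> s) x) = x"
  using group.l_inv[OF group_Homeo0 assms] group.r_inv[OF group_Homeo0 assms]
  by (auto simp: fun_eq_iff)

lemma affine_in_Homeo0:
  fixes a b :: real
  assumes "a > 0"
  shows "(\<lambda>x. a * x + b) \<in> carrier Homeo0"
proof -
  have "\<exists>x. y = a * x + b" for y
    using assms by (intro exI[of _ "(y - b) / a"]) simp
  then have "surj (\<lambda>x. a * x + b)"
    by (auto simp: surj_def)
  then show ?thesis
    using assms by (auto simp: carrier_Homeo0_iff strict_mono_def intro!: continuous_intros)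
qed

lemma topspace_compact_open_Homeo0: "topspace compact_open_Homeo0 = carrier Homeo0"
proof -
  let ?S = "{{f \<in> carrier Homeo0. f ` K \<subseteq> U} | K U. compact K \<and> open U}"
  have "{f \<in> carrier Homeo0. f ` {} \<subseteq> UNIV} \<in> ?S"
    by (rule CollectI, rule exI[of _ "{}"], rule exI[of _ UNIV]) simp
  then show ?thesis
    unfolding compact_open_Homeo0_def topology_generated_by_topspace by blast
qed

text \<open>Only the sub-basic sets have to be checked, and there uniform convergence on bounded
  intervals is enough, because the compact set \<open>l ` K\<close> has an \<open>\<epsilon>\<close>-neighbourhood inside the open
  set \<open>U\<close>.\<close>

lemma limitin_compact_open:
  assumes l: "l \<in> carrier Homeo0"
    and F: "\<And>n. F n \<in> carrier Homeo0"
    and conv: "\<And>R \<epsilon>. \<epsilon> > 0 \<Longrightarrow> \<forall>\<^sub>F n in sequentially. \<forall>z. \<bar>z\<bar> \<le> R \<longrightarrow> \<bar>F n z - l z\<bar> < \<epsilon>"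
  shows "limitin compact_open_Homeo0 F l sequentially"
proof -
  let ?S = "{{f \<in> carrier Homeo0. f ` K \<subseteq> U} | K U. compact K \<and> open U}"
  have "l \<in> V \<longrightarrow> (\<forall>\<^sub>F n in sequentially. F n \<in> V)" if "generate_topology_on ?S V" for V
    using that
  proof induction
    case (Int V W)
    then show ?case by (simp add: eventually_conj_iff)
  next
    case (UN K)
    show ?case
    proof
      assume "l \<in> \<Union>K"
      then obtain V where V: "V \<in> K" "l \<in> V" by blast
      then have "\<forall>\<^sub>F n in sequentially. F n \<in> V"
        using UN.IH by blast
      then show "\<forall>\<^sub>F n in sequentially. F n \<in> \<Union>K"
        by (rule eventually_mono) (use V in blast)
    qed
  next
    case (Basis V)
    then obtain K U where V: "V = {f \<in> carrier Homeo0. f ` K \<subseteq> U}" and "compact K" "open U"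
      by auto
    show ?case
    proof
      assume "l \<in> V"
      have "compact (l ` K)"
        using l \<open>compact K\<close> compact_continuous_image continuous_on_subset
        by (metis carrier_Homeo0_iff top_greatest)
      then obtain \<epsilon> where "\<epsilon> > 0" and \<epsilon>: "(\<Union>y\<in>l ` K. ball y \<epsilon>) \<subseteq> U"
        using compact_subset_open_imp_ball_epsilon_subset[of "l ` K" U] \<open>open U\<close> \<open>l \<in> V\<close> V
        by blast
      obtain R where R: "\<And>z. z \<in> K \<Longrightarrow> \<bar>z\<bar> \<le> R"
        using \<open>compact K\<close> compact_imp_bounded bounded_iff by (metis real_norm_def)
      show "\<forall>\<^sub>F n in sequentially. F n \<in> V"
        using conv[OF \<open>\<epsilon> > 0\<close>, of R]
      proof eventually_elim
        case (elim n)
        have "F n z \<in> U" if "z \<in> K" for z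
        proof -
          have "F n z \<in> ball (l z) \<epsilon>"
            using elim R[OF that] by (auto simp: dist_real_def abs_minus_commute)
          then show ?thesis using \<epsilon> that by blast
        qed
        then show ?case using F V by auto
      qed
    qed
  qed auto
  then show ?thesis
    using l topspace_compact_open_Homeo0
    by (auto simp: limitin_def compact_open_Homeo0_def openin_topology_generated_by_iff)
qed

section \<open>Levels and homeomorphisms that approximate them\<close>

text \<open>In the application \<open>i\<close> runs through \<open>B\<close>, \<open>v i\<close> is its position \<open>i \<xi>\<close> and \<open>u i\<close> is the
  point of the line that represents the configuration with the single lamp \<open>i\<close>. The level is
  then the measure \<open>P\<close> of a point, cut off below at \<open>- m\<close>. The cut-off makes the level total:
  points to the left of all \<open>u i\<close>, where the supremum would be over the empty set, get the value
  \<open>- m\<close>.\<close>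

definition level :: "'i set \<Rightarrow> ('i \<Rightarrow> real) \<Rightarrow> ('i \<Rightarrow> real) \<Rightarrow> real \<Rightarrow> real \<Rightarrow> real" where
  "level I v u m x = Sup (insert (- m) (v ` {i \<in> I. u i \<le> x}))"

locale cofinal_dense_family =
  fixes I :: "'i set" and v u :: "'i \<Rightarrow> real"
  assumes dense: "\<And>x y. x < y \<Longrightarrow> \<exists>i\<in>I. x < v i \<and> v i < y"
    and mono: "\<And>i k. i \<in> I \<Longrightarrow> k \<in> I \<Longrightarrow> v i < v k \<Longrightarrow> u i < u k"
    and cofinal: "\<And>x. \<exists>i\<in>I. x < u i"
begin

abbreviation "lev \<equiv> level I v u"

lemma bdd_above_level: "bdd_above (insert (- m) (v ` {i \<in> I. u i \<le> x}))"
proof -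
  obtain k where k: "k \<in> I" "x < u k"
    using cofinal by blast
  have "v i \<le> v k" if "i \<in> I" "u i \<le> x" for i
    using mono[of k i] k that by force
  then have "bdd_above (v ` {i \<in> I. u i \<le> x})"
    by (intro bdd_aboveI[of _ "v k"]) auto
  then show ?thesis by simp
qed

lemma level_ge: "- m \<le> lev m x"
  unfolding level_def by (rule cSup_upper[OF _ bdd_above_level]) simp

lemma le_level: "i \<in> I \<Longrightarrow> u i \<le> x \<Longrightarrow> v i \<le> lev m x"
  unfolding level_def by (rule cSup_upper[OF _ bdd_above_level]) simp

lemma level_le: "- m \<le> y \<Longrightarrow> (\<And>i. i \<in> I \<Longrightarrow> u i \<le> x \<Longrightarrow> v i \<le> y) \<Longrightarrow> lev m x \<le> y"
  unfolding level_def by (rule cSup_least) auto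

lemma below_level:
  assumes "i \<in> I" "v i < lev m x" "- m < lev m x"
  shows "u i < x"
proof -
  have "max (v i) (- m) < lev m x"
    using assms by simp
  then obtain k where "k \<in> I" "u k \<le> x" "v i < v k"
    unfolding level_def using less_cSup_iff[OF _ bdd_above_level[of m x], of "max (v i) (- m)"] by auto
  then show ?thesis
    using mono[of i k] assms by force
qed

lemma above_level: "i \<in> I \<Longrightarrow> lev m x < v i \<Longrightarrow> x < u i"
  using le_level[of i x m] by force

lemma mono_level: "x \<le> y \<Longrightarrow> lev m x \<le> lev m y"
  by (rule level_le[OF level_ge]) (auto intro: le_level)

lemma level_le_of_le: "i \<in> I \<Longrightarrow> x \<le> u i \<Longrightarrow> lev m x \<le> max (- m) (v i)"
  by (rule level_le) (use mono in \<open>force intro: le_max_iff_disj[THEN iffD2]\<close>)+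

text \<open>A nondecreasing function cannot jump if its values are dense. Here they are dense above
  \<open>- m\<close> only, so the left-hand bound is trivial where the level is \<open>- m\<close>.\<close>

lemma continuous_level: "continuous_on UNIV (lev m)"
  unfolding continuous_on_iff
proof (intro ballI allI impI)
  fix x \<epsilon> :: real
  assume "\<epsilon> > 0"
  obtain i where i: "i \<in> I" "lev m x < v i" "v i < lev m x + \<epsilon>"
    using dense[of "lev m x" "lev m x + \<epsilon>"] \<open>\<epsilon> > 0\<close> by auto
  have right: "lev m y < lev m x + \<epsilon>" if "y < u i" for y
    using level_le_of_le[of i y m] level_ge[of m x] that i by auto
  obtain l where "l < x" and left: "\<And>y. l < y \<Longrightarrow> lev m x - \<epsilon> < lev m y"
  proof (cases "lev m x = - m")
    case True
    then have "lev m x - \<epsilon> < lev m y" for y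
      using level_ge[of m y] \<open>\<epsilon> > 0\<close> by linarith
    then show ?thesis
      using that[of "x - 1"] by simp
  next
    case False
    then have "- m < lev m x"
      using level_ge[of m x] by linarith
    obtain k where k: "k \<in> I" "lev m x - \<epsilon> < v k" "v k < lev m x"
      using dense[of "lev m x - \<epsilon>" "lev m x"] \<open>\<epsilon> > 0\<close> by auto
    show ?thesis
    proof (rule that)
      show "u k < x"
        using below_level k \<open>- m < lev m x\<close> by blast
      show "lev m x - \<epsilon> < lev m y" if "u k < y" for y
        using le_level[of k y m] k that by simp
    qed
  qed
  show "\<exists>d>0. \<forall>y\<in>UNIV. dist y x < d \<longrightarrow> dist (lev m y) (lev m x) < \<epsilon>"
  proof (intro exI[of _ "min (x - l) (u i - x)"] conjI ballI impI)
    show "0 < min (x - l) (u i - x)"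
      using \<open>l < x\<close> above_level i by simp
    fix y assume "dist y x < min (x - l) (u i - x)"
    then have "l < y" "y < u i"
      by (auto simp: dist_real_def abs_less_iff)
    then show "dist (lev m y) (lev m x) < \<epsilon>"
      using left[of y] right[of y] by (auto simp: dist_real_def abs_less_iff)
  qed
qed

text \<open>The two hypotheses on \<open>f\<close> say that \<open>f (u i)\<close> lies on the same side of \<open>u k\<close> as the affine
  image of \<open>v i\<close> does of \<open>v k\<close>, provided that the larger of the latter two positions exceeds \<open>M\<close>;
  nothing is known about comparisons below \<open>M\<close>. If the two sides of the conclusion differed, some
  \<open>v k > M\<close> would lie strictly between them, and comparing \<open>f x\<close> with \<open>u k\<close> through some
  \<open>u i\<close> with \<open>v i\<close> close to the level of \<open>x\<close> gives a contradiction.\<close>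

lemma level_equivariant:
  assumes f: "strict_mono f" and a: "a > 0"
    and lower: "\<And>i k. i \<in> I \<Longrightarrow> k \<in> I \<Longrightarrow> M < a * v i + b \<Longrightarrow> v k < a * v i + b \<Longrightarrow> u k < f (u i)"
    and upper: "\<And>i k. i \<in> I \<Longrightarrow> k \<in> I \<Longrightarrow> M < v k \<Longrightarrow> a * v i + b < v k \<Longrightarrow> f (u i) < u k"
    and x: "- m < lev m x" "- m < a * lev m x + b" "M < a * lev m x + b"
  shows "lev m (f x) = a * lev m x + b"
proof (rule antisym; rule ccontr)
  assume "\<not> lev m (f x) \<le> a * lev m x + b"
  then obtain k where k: "k \<in> I" "a * lev m x + b < v k" "v k < lev m (f x)"
    using dense by (meson not_le)
  then have "lev m x < (v k - b) / a"
    using a by (simp add: field_simps)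
  then obtain i where i: "i \<in> I" "lev m x < v i" "v i < (v k - b) / a"
    using dense by blast
  then have "f (u i) < u k"
    using upper[of i k] k x a by (simp add: field_simps)
  moreover have "u k < f x"
    using below_level[of k m "f x"] k x by auto
  moreover have "f x < f (u i)"
    using above_level i f by (simp add: strict_mono_def)
  ultimately show False by simp
next
  assume "\<not> a * lev m x + b \<le> lev m (f x)"
  then obtain k where k: "k \<in> I" "max M (lev m (f x)) < v k" "v k < a * lev m x + b"
    using dense[of "max M (lev m (f x))" "a * lev m x + b"] x by auto
  then have "(v k - b) / a < lev m x"
    using a by (simp add: field_simps)
  then obtain i where i: "i \<in> I" "(v k - b) / a < v i" "v i < lev m x"
    using dense by blast
  then have "u k < f (u i)"
    using lower[of i k] k a by (simp add: field_simps)
  also have "\<dots> < f x"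
    using below_level[of i m x] i x f by (simp add: strict_mono_def)
  finally show False
    using le_level[of k "f x" m] k by simp
qed

text \<open>The level fails to be a homeomorphism for two reasons: it is not strictly increasing,
  and it is bounded below. A small multiple of the arctangent repairs the first, uniformly on the
  line; a linear term, which only acts where the level is constantly \<open>- m\<close>, repairs the second.
  No lower bound on \<open>s\<close> can hold there, but the upper bound still keeps \<open>s\<close> far to the left.\<close>

lemma homeomorphism_near_level:
  assumes "\<epsilon> > 0"
  shows "\<exists>s\<in>carrier Homeo0. \<forall>x. s x \<le> lev m x + \<epsilon> \<and> (- m < lev m x \<longrightarrow> lev m x - \<epsilon> \<le> s x)"
proof -
  obtain c where c: "c \<in> I" "v c < - m"
    using dense[of "- m - 1" "- m"] by auto
  \<comment> \<open>The arctangent is bounded by 2, whence the factor.\<close>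
  define \<delta> where "\<delta> = \<epsilon> / 2"
  have "\<delta> > 0" using assms by (simp add: \<delta>_def)
  define s where "s x = lev m x + \<delta> * arctan x + min 0 (x - u c)" for x
  have arctan: "\<bar>\<delta> * arctan x\<bar> \<le> \<epsilon>" for x
  proof -
    have "\<bar>arctan x\<bar> \<le> 2"
      using arctan_lbound[of x] arctan_ubound[of x] pi_less_4 by linarith
    then show ?thesis
      using assms by (simp add: \<delta>_def abs_mult)
  qed
  have far_left: "lev m x = - m" if "x \<le> u c" for x
    using level_le_of_le[of c x m] level_ge[of m x] c that by simp
  have cont: "continuous_on UNIV s"
    unfolding s_def by (intro continuous_intros continuous_level)
  have "strict_mono s"
  proof (rule strict_monoI)
    fix x y :: real assume "x < y"
    then have "\<delta> * arctan x < \<delta> * arctan y"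
      using \<open>\<delta> > 0\<close> arctan_less_iff by simp
    then show "s x < s y"
      using mono_level[of x y m] \<open>x < y\<close> by (simp add: s_def)
  qed
  moreover have "surj s"
  proof -
    have "\<exists>x. s x = z" for z
    proof -
      \<comment> \<open>Left of \<open>u c\<close> the value \<open>s l\<close> is at most \<open>- m + \<epsilon> + (l - u c)\<close>.\<close>
      define l where "l = min (u c) (u c + m + z - \<epsilon>)"
      have "s l \<le> z"
        using far_left[of l] arctan[of l] by (auto simp: s_def l_def)
      obtain i where i: "i \<in> I" "max z (- m) + \<epsilon> < v i"
        using dense[of "max z (- m) + \<epsilon>"  "max z (- m) + \<epsilon> + 1"] by auto
      have "u c < u i"
        using mono c i assms by force
      moreover have "v i \<le> lev m (u i)"
        using le_level i by simp
      ultimately have "z \<le> s (u i)"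
        using i arctan[of "u i"] by (auto simp: s_def)
      moreover have "l \<le> u i"
        using \<open>u c < u i\<close> by (auto simp: l_def)
      ultimately show ?thesis
        using IVT'[of s l z "u i"] \<open>s l \<le> z\<close> continuous_on_subset[OF cont] by blast
    qed
    then show ?thesis by (metis surjI)
  qed
  ultimately have "s \<in> carrier Homeo0"
    using cont by (simp add: carrier_Homeo0_iff)
  moreover have "s x \<le> lev m x + \<epsilon>" for x
    using arctan[of x] by (auto simp: s_def)
  moreover have "lev m x - \<epsilon> \<le> s x" if "- m < lev m x" for x
    using far_left[of x] that arctan[of x] by (force simp: s_def)
  ultimately show ?thesis by blast
qed

text \<open>Pull a point \<open>z\<close> of a bounded interval back to \<open>x\<close> with \<open>s n x = z\<close>. For large \<open>n\<close> the
  upper bound on \<open>s n\<close> forces the level of \<open>x\<close> above the cut-off, so it is within \<open>1/(n+1)\<close> of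
  \<open>z\<close>. Equivariance gives the exact level of \<open>F n x\<close>, and \<open>s n\<close> changes it by at most
  \<open>1/(n+1)\<close> again. The total error is at most \<open>(1 + a) / (n + 1)\<close>.\<close>

lemma conjugates_converge:
  assumes s: "\<And>n. s n \<in> carrier Homeo0"
    and near: "\<And>n x. s n x \<le> lev (real n) x + 1 / Suc n"
      "\<And>n x. - real n < lev (real n) x \<Longrightarrow> lev (real n) x - 1 / Suc n \<le> s n x"
    and F: "\<And>n. F n \<in> carrier Homeo0" and a: "a > 0"
    and lower: "\<And>M. \<forall>\<^sub>F n in sequentially. \<forall>i\<in>I. \<forall>k\<in>I.
      M < a * v i + b \<longrightarrow> v k < a * v i + b \<longrightarrow> u k < F n (u i)"
    and upper: "\<And>M. \<forall>\<^sub>F n in sequentially. \<forall>i\<in>I. \<forall>k\<in>I.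
      M < v k \<longrightarrow> a * v i + b < v k \<longrightarrow> F n (u i) < u k"
  shows "limitin compact_open_Homeo0 (\<lambda>n. s n \<circ> F n \<circ> inv\<^bsub>Homeo0\<^esub> (s n)) (\<lambda>x. a * x + b) sequentially"
proof (rule limitin_compact_open)
  show "(\<lambda>x. a * x + b) \<in> carrier Homeo0"
    by (rule affine_in_Homeo0[OF a])
  show "s n \<circ> F n \<circ> inv\<^bsub>Homeo0\<^esub> (s n) \<in> carrier Homeo0" for n
    using conjugate_in_Homeo0[OF s F] by simp
next
  fix R \<epsilon> :: real
  assume "\<epsilon> > 0"
  \<comment> \<open>The level of \<open>x\<close> will be at least \<open>- R - 1\<close>, so its image under the affine map exceeds \<open>M\<close>.\<close>
  define M where "M = - a * (R + 1) + b - 1"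
  have "\<forall>\<^sub>F n in sequentially. max (R + 2) (- M) < real n"
    using filterlim_real_sequentially unfolding filterlim_at_top_dense by blast
  moreover have "\<forall>\<^sub>F n in sequentially. (1 + a) / \<epsilon> < real n"
    using filterlim_real_sequentially unfolding filterlim_at_top_dense by blast
  ultimately show "\<forall>\<^sub>F n in sequentially. \<forall>z. \<bar>z\<bar> \<le> R \<longrightarrow>
      \<bar>(s n \<circ> F n \<circ> inv\<^bsub>Homeo0\<^esub> (s n)) z - (a * z + b)\<bar> < \<epsilon>"
    using lower[of M] upper[of M]
  proof eventually_elim
    case (elim n)
    define \<delta> where "\<delta> = 1 / real (Suc n)"
    have \<delta>: "0 < \<delta>" "\<delta> \<le> 1"
      by (simp_all add: \<delta>_def)
    have "(1 + a) / \<epsilon> < real (Suc n)"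
      using elim(2) by simp
    then have small: "(1 + a) * \<delta> < \<epsilon>"
      using \<open>\<epsilon> > 0\<close> by (simp add: \<delta>_def field_simps)
    show ?case
    proof (intro allI impI)
      fix z assume z: "\<bar>z\<bar> \<le> R"
      define x where "x = (inv\<^bsub>Homeo0\<^esub> (s n)) z"
      let ?p = "lev (real n) x"
      have sx: "s n x = z"
        unfolding x_def by (rule inv_Homeo0_apply[OF s])
      have p_ge: "z - \<delta> \<le> ?p"
        using near(1)[of n x] sx by (simp add: \<delta>_def)
      then have p: "- real n < ?p"
        using elim(1) z \<delta> by auto
      then have p_le: "?p \<le> z + \<delta>"
        using near(2)[of n x] sx by (simp add: \<delta>_def)
      have "a * (- (R + 1)) \<le> a * ?p"
        using p_ge z \<delta> a by (intro mult_left_mono) auto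
      then have M: "M < a * ?p + b"
        by (simp add: M_def algebra_simps)
      then have n: "- real n < a * ?p + b"
        using elim(1) by auto
      have level_F: "lev (real n) (F n x) = a * ?p + b"
      proof (rule level_equivariant[OF _ a _ _ p n M])
        show "strict_mono (F n)"
          using F[of n] by (simp add: carrier_Homeo0_iff)
      qed (use elim(3,4) in blast)+
      have "\<bar>s n (F n x) - (a * ?p + b)\<bar> \<le> \<delta>"
        using near[of n "F n x"] n by (auto simp: level_F \<delta>_def abs_le_iff)
      moreover have "\<bar>a * ?p - a * z\<bar> \<le> a * \<delta>"
      proof -
        have "\<bar>a * ?p - a * z\<bar> = a * \<bar>?p - z\<bar>"
          using a by (simp add: abs_mult flip: right_diff_distrib)
        also have "\<dots> \<le> a * \<delta>"
          using p_ge p_le a by (intro mult_left_mono) auto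
        finally show ?thesis .
      qed
      ultimately have "\<bar>s n (F n x) - (a * z + b)\<bar> \<le> (1 + a) * \<delta>"
        by (simp add: algebra_simps)
      then show "\<bar>(s n \<circ> F n \<circ> inv\<^bsub>Homeo0\<^esub> (s n)) z - (a * z + b)\<bar> < \<epsilon>"
        using small by (simp add: x_def)
    qed
  qed
qed

end

section \<open>Irreducible actions\<close>

lemma Hom_irr_compose:
  assumes closed: "\<And>g h. g \<in> carrier G \<Longrightarrow> h \<in> carrier G \<Longrightarrow> g \<otimes>\<^bsub>G\<^esub> h \<in> carrier G"
    and \<phi>: "\<phi> \<in> Hom_irr G" and \<sigma>: "\<sigma> \<in> hom G G" "\<sigma> ` carrier G = carrier G"
  shows "compose (carrier G) \<phi> \<sigma> \<in> Hom_irr G"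
proof -
  have "compose (carrier G) \<phi> \<sigma> \<in> hom G Homeo0"
  proof (rule homI)
    show "compose (carrier G) \<phi> \<sigma> g \<in> carrier Homeo0" if "g \<in> carrier G" for g
      using that \<phi> hom_in_carrier[OF \<sigma>(1)] hom_in_carrier[of \<phi> G Homeo0]
      by (simp add: compose_def Hom_irr_def)
  next
    fix g h assume "g \<in> carrier G" "h \<in> carrier G"
    moreover from this have "\<phi> (\<sigma> (g \<otimes>\<^bsub>G\<^esub> h)) = \<phi> (\<sigma> g) \<otimes>\<^bsub>Homeo0\<^esub> \<phi> (\<sigma> h)"
      using \<phi> hom_mult[OF \<sigma>(1)] hom_in_carrier[OF \<sigma>(1)] hom_mult[of \<phi> G Homeo0]
      by (simp add: Hom_irr_def)
    ultimately show "compose (carrier G) \<phi> \<sigma> (g \<otimes>\<^bsub>G\<^esub> h) =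
        compose (carrier G) \<phi> \<sigma> g \<otimes>\<^bsub>Homeo0\<^esub> compose (carrier G) \<phi> \<sigma> h"
      using closed by (simp add: compose_def)
  qed
  moreover have "\<nexists>x. \<forall>g\<in>carrier G. compose (carrier G) \<phi> \<sigma> g x = x"
  proof (intro notI, elim exE)
    fix x assume x: "\<forall>g\<in>carrier G. compose (carrier G) \<phi> \<sigma> g x = x"
    have "\<phi> h x = x" if h: "h \<in> carrier G" for h
    proof -
      obtain g where "g \<in> carrier G" "h = \<sigma> g"
        using h \<sigma>(2) by blast
      then show ?thesis
        using x[rule_format, of g] by (simp add: compose_def)
    qed
    then show False
      using \<phi> unfolding Hom_irr_def by blast
  qed
  ultimately show ?thesis
    by (simp add: Hom_irr_def)
qed

lemma Hom_irr_conj_action: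
  assumes closed: "\<And>g h. g \<in> carrier G \<Longrightarrow> h \<in> carrier G \<Longrightarrow> g \<otimes>\<^bsub>G\<^esub> h \<in> carrier G"
    and \<phi>: "\<phi> \<in> Hom_irr G" and s: "s \<in> carrier Homeo0"
  shows "conj_action G s \<phi> \<in> Hom_irr G"
proof -
  have "conj_action G s \<phi> \<in> hom G Homeo0"
  proof (rule homI)
    fix g assume "g \<in> carrier G"
    then show "conj_action G s \<phi> g \<in> carrier Homeo0"
      using \<phi> conjugate_in_Homeo0[OF s] hom_in_carrier[of \<phi> G Homeo0]
      by (simp add: conj_action_def Hom_irr_def)
  next
    fix g h assume "g \<in> carrier G" "h \<in> carrier G"
    moreover from this have "\<phi> (g \<otimes>\<^bsub>G\<^esub> h) = \<phi> g \<circ> \<phi> h"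
      using \<phi> hom_mult[of \<phi> G Homeo0] by (simp add: Hom_irr_def)
    ultimately show "conj_action G s \<phi> (g \<otimes>\<^bsub>G\<^esub> h) = conj_action G s \<phi> g \<otimes>\<^bsub>Homeo0\<^esub> conj_action G s \<phi> h"
      using closed by (simp add: conj_action_def fun_eq_iff inv_Homeo0_apply[OF s])
  qed
  moreover have "\<nexists>x. \<forall>g\<in>carrier G. conj_action G s \<phi> g x = x"
  proof (intro notI, elim exE)
    fix x assume x: "\<forall>g\<in>carrier G. conj_action G s \<phi> g x = x"
    have "\<phi> g ((inv\<^bsub>Homeo0\<^esub> s) x) = (inv\<^bsub>Homeo0\<^esub> s) x" if "g \<in> carrier G" for g
    proof -
      have "s (\<phi> g ((inv\<^bsub>Homeo0\<^esub> s) x)) = x"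
        using x[rule_format, OF that] that by (simp add: conj_action_def)
      then show ?thesis
        using inv_Homeo0_apply(1)[OF s] by metis
    qed
    then show False
      using \<phi> unfolding Hom_irr_def by blast
  qed
  ultimately show ?thesis
    by (simp add: Hom_irr_def conj_action_def)
qed

lemma limitin_Hom_irr:
  assumes "\<phi> \<in> Hom_irr G" and "\<And>n. \<Phi> n \<in> Hom_irr G"
    and "\<And>g. g \<in> carrier G \<Longrightarrow> limitin compact_open_Homeo0 (\<lambda>n. \<Phi> n g) (\<phi> g) F"
  shows "limitin (Hom_irr_topology G) \<Phi> \<phi> F"
  unfolding Hom_irr_topology_def limitin_subtopology limitin_componentwise
  using assms
  by (auto simp: topspace_compact_open_Homeo0 Hom_irr_def hom_def PiE_def)

section \<open>The wreath product and its automorphisms\<close>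

context group
begin

lemma lamps_iff: "f \<in> lamps G \<longleftrightarrow> (\<forall>k. k \<notin> carrier G \<longrightarrow> f k = 0) \<and> finite {k. f k \<noteq> 0}"
proof -
  have "{k \<in> carrier G. f k \<noteq> 0} = {k. f k \<noteq> 0}" if "\<forall>k. k \<notin> carrier G \<longrightarrow> f k = 0"
    using that by auto
  then show ?thesis
    by (auto simp: lamps_def)
qed

lemma left_reg_in_lamps:
  assumes "b \<in> carrier G" "f \<in> lamps G"
  shows "left_reg G b f \<in> lamps G"
proof -
  have "{k. left_reg G b f k \<noteq> 0} \<subseteq> (\<lambda>k. b \<otimes> k) ` {k. f k \<noteq> 0}"
  proof
    fix k assume "k \<in> {k. left_reg G b f k \<noteq> 0}"
    then have "k \<in> carrier G" "f (inv b \<otimes> k) \<noteq> 0"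
      by (auto simp: left_reg_def split: if_splits)
    then show "k \<in> (\<lambda>k. b \<otimes> k) ` {k. f k \<noteq> 0}"
      using assms by (intro image_eqI[of _ _ "inv b \<otimes> k"]) (auto simp flip: m_assoc)
  qed
  moreover have "finite {k. f k \<noteq> 0}"
    using assms by (simp add: lamps_iff)
  ultimately have "finite {k. left_reg G b f k \<noteq> 0}"
    using finite_subset by blast
  then show ?thesis
    by (simp add: lamps_iff left_reg_def)
qed

lemma right_reg_in_lamps:
  assumes "t \<in> carrier G" "f \<in> lamps G"
  shows "right_reg G t f \<in> lamps G"
proof -
  have "{k. right_reg G t f k \<noteq> 0} \<subseteq> (\<lambda>k. k \<otimes> inv t) ` {k. f k \<noteq> 0}"
  proof
    fix k assume "k \<in> {k. right_reg G t f k \<noteq> 0}"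
    then have "k \<in> carrier G" "f (k \<otimes> t) \<noteq> 0"
      by (auto simp: right_reg_def split: if_splits)
    then show "k \<in> (\<lambda>k. k \<otimes> inv t) ` {k. f k \<noteq> 0}"
      using assms by (intro image_eqI[of _ _ "k \<otimes> t"]) (auto simp: m_assoc)
  qed
  moreover have "finite {k. f k \<noteq> 0}"
    using assms by (simp add: lamps_iff)
  ultimately have "finite {k. right_reg G t f k \<noteq> 0}"
    using finite_subset by blast
  then show ?thesis
    by (simp add: lamps_iff right_reg_def)
qed

lemma wreath_mult_closed:
  assumes "g \<in> carrier (wreath G)" "h \<in> carrier (wreath G)"
  shows "g \<otimes>\<^bsub>wreath G\<^esub> h \<in> carrier (wreath G)"
proof -
  obtain f b f' b' where [simp]: "g = (f, b)" "h = (f', b')"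
    by (cases g, cases h)
  have f: "f \<in> lamps G" and f': "left_reg G b f' \<in> lamps G"
    using assms left_reg_in_lamps by (auto simp: wreath_def)
  have "finite ({k. f k \<noteq> 0} \<union> {k. left_reg G b f' k \<noteq> 0})"
    using f f' by (simp add: lamps_iff)
  then have "finite {k. f k + left_reg G b f' k \<noteq> 0}"
    by (rule rev_finite_subset) auto
  then have "(\<lambda>k. f k + left_reg G b f' k) \<in> lamps G"
    using f f' by (simp add: lamps_iff)
  then show ?thesis
    using assms by (auto simp: wreath_def)
qed

lemma wreath_aut_hom:
  assumes "t \<in> carrier G"
  shows "wreath_aut G t \<in> hom (wreath G) (wreath G)"
proof (rule homI)
  fix g assume "g \<in> carrier (wreath G)"
  then show "wreath_aut G t g \<in> carrier (wreath G)"
    using assms right_reg_in_lamps by (auto simp: wreath_def wreath_aut_def)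
next
  fix g h assume "g \<in> carrier (wreath G)" "h \<in> carrier (wreath G)"
  then show "wreath_aut G t (g \<otimes>\<^bsub>wreath G\<^esub> h) = wreath_aut G t g \<otimes>\<^bsub>wreath G\<^esub> wreath_aut G t h"
    using assms
    by (auto simp: wreath_def wreath_aut_def right_reg_def left_reg_def fun_eq_iff m_assoc)
qed

lemma wreath_aut_image:
  assumes t: "t \<in> carrier G"
  shows "wreath_aut G t ` carrier (wreath G) = carrier (wreath G)"
proof
  show "wreath_aut G t ` carrier (wreath G) \<subseteq> carrier (wreath G)"
    using wreath_aut_hom[OF t] by (auto simp: hom_def)
  show "carrier (wreath G) \<subseteq> wreath_aut G t ` carrier (wreath G)"
  proof
    fix g assume g: "g \<in> carrier (wreath G)"
    have "wreath_aut G t (wreath_aut G (inv t) g) = g"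
      using g t
      by (auto simp: wreath_def wreath_aut_def right_reg_def lamps_def fun_eq_iff m_assoc)
    moreover have "wreath_aut G (inv t) g \<in> carrier (wreath G)"
      using g t wreath_aut_hom[of "inv t"] by (auto simp: hom_def)
    ultimately show "g \<in> wreath_aut G t ` carrier (wreath G)"
      by (metis imageI)
  qed
qed

lemma wreath_aut_funpow:
  assumes "t \<in> carrier G"
  shows "wreath_aut G t ^^ n \<in> hom (wreath G) (wreath G)"
    and "(wreath_aut G t ^^ n) ` carrier (wreath G) = carrier (wreath G)"
proof (induction n)
  case 0
  { case 1 show ?case by (simp add: hom_def) }
  { case 2 show ?case by simp }
next
  case (Suc n)
  { case 1 show ?case
      using Suc(1) wreath_aut_hom[OF assms] by (auto simp: hom_def Pi_iff) }
  { case 2 show ?case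
      using Suc(2) wreath_aut_image[OF assms] by (metis funpow.simps(2) image_comp) }
qed

lemma wreath_aut_funpow_apply: "(wreath_aut G t ^^ n) (r, b) = ((right_reg G t ^^ n) r, b)"
  by (induction n) (simp_all add: wreath_aut_def)

end

section \<open>Groups of affine maps\<close>

locale affine_group =
  fixes H :: "(real \<Rightarrow> real) set" and B
  defines "B \<equiv> Aff\<lparr>carrier := H\<rparr>"
  assumes affine: "H \<subseteq> carrier Aff" and group: "group B"
begin

sublocale B: group B
  by (rule group)

lemma B_simps [simp]: "carrier B = H" "f \<otimes>\<^bsub>B\<^esub> g = f \<circ> g" "\<one>\<^bsub>B\<^esub> = id"
  by (simp_all add: B_def Aff_def Homeo0_def)

lemma affineE:
  assumes "f \<in> H"
  obtains a b where "a > 0" "f = (\<lambda>x. a * x + b)"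
  using assms affine by (auto simp: Aff_def)

lemma comp_closed: "f \<in> H \<Longrightarrow> g \<in> H \<Longrightarrow> f \<circ> g \<in> H"
  using B.m_closed[of f g] by simp

lemma inv_apply:
  assumes "f \<in> H"
  shows "(inv\<^bsub>B\<^esub> f) (f x) = x" "f ((inv\<^bsub>B\<^esub> f) x) = x"
  using B.l_inv[of f] B.r_inv[of f] assms by (simp_all add: fun_eq_iff)

lemma inv_affine_in:
  assumes "(\<lambda>x. a * x + b) \<in> H" "a > 0"
  shows "(\<lambda>x. (x - b) / a) \<in> H"
proof -
  let ?f = "\<lambda>x. a * x + b"
  have "inv\<^bsub>B\<^esub> ?f = (\<lambda>x. (x - b) / a)"
  proof
    fix x show "(inv\<^bsub>B\<^esub> ?f) x = (x - b) / a"
      using inv_apply(2)[OF assms(1), of x] assms(2) by (simp add: field_simps)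
  qed
  then show ?thesis
    using B.inv_closed[of ?f] assms(1) by simp
qed

lemma in_Homeo0: "f \<in> H \<Longrightarrow> f \<in> carrier Homeo0"
  using affine_in_Homeo0 by (elim affineE) auto

text \<open>If all slopes were 1, the group would consist of translations, which commute. An
  element of slope greater than 1 has a contraction as its inverse.\<close>

lemma contraction_exists:
  assumes "\<not> comm_group B"
  obtains a b where "0 < a" "a < 1" "(\<lambda>x. a * x + b) \<in> H"
proof -
  have "\<exists>f\<in>H. \<exists>a b. a > 0 \<and> a \<noteq> 1 \<and> f = (\<lambda>x. a * x + b)"
  proof (rule ccontr)
    assume *: "\<not> ?thesis"
    have translation: "\<exists>b. f = (\<lambda>x. x + b)" if f: "f \<in> H" for f
    proof -
      obtain a b where ab: "a > 0" "f = (\<lambda>x. a * x + b)"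
        using affineE[OF f] .
      then have "a = 1"
        using * f by blast
      with ab show ?thesis by auto
    qed
    have "f \<circ> g = g \<circ> f" if "f \<in> H" "g \<in> H" for f g
      using translation[OF that(1)] translation[OF that(2)] by (auto simp: fun_eq_iff)
    then have "comm_group B"
      by (intro B.group_comm_groupI) simp
    with assms show False by blast
  qed
  then obtain a b where ab: "a > 0" "a \<noteq> 1" "(\<lambda>x. a * x + b) \<in> H"
    by blast
  show thesis
  proof (cases "a < 1")
    case True
    with ab that show ?thesis by blast
  next
    case False
    have "(\<lambda>x. (x - b) / a) = (\<lambda>x. (1 / a) * x + (- b / a))"
      by (auto simp: fun_eq_iff diff_divide_distrib)
    then have "(\<lambda>x. (1 / a) * x + (- b / a)) \<in> H"
      using inv_affine_in[OF ab(3,1)] by simp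
    then show ?thesis
      using False ab by (intro that[of "1 / a" "- b / a"]) auto
  qed
qed

text \<open>Conjugating the translation by \<open>c\<close> with the \<open>n\<close>-th power of a contraction of slope \<open>a\<close>
  gives the translation by \<open>a\<^sup>n c\<close>. So there are arbitrarily small translations, whose multiples
  already move \<open>\<xi>\<close> into every interval.\<close>

lemma dense_orbit:
  assumes "\<not> comm_group B" and t: "(\<lambda>x. x + c) \<in> H" and c: "c > 0" and "x < y"
  shows "\<exists>b\<in>H. x < b \<xi> \<and> b \<xi> < y"
proof -
  obtain a b where a: "0 < a" "a < 1" and f: "(\<lambda>x. a * x + b) \<in> H"
    using contraction_exists assms by blast
  have small: "(\<lambda>x. x + a ^ n * c) \<in> H" for n
  proof (induction n)
    case 0
    show ?case using t by simp
  next
    case (Suc n)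
    let ?f = "\<lambda>x. a * x + b"
    have "?f \<circ> ((\<lambda>x. x + a ^ n * c) \<circ> (\<lambda>x. (x - b) / a)) \<in> H"
      using comp_closed[OF f comp_closed[OF Suc inv_affine_in[OF f a(1)]]] .
    moreover have "?f \<circ> ((\<lambda>x. x + a ^ n * c) \<circ> (\<lambda>x. (x - b) / a)) = (\<lambda>x. x + a ^ Suc n * c)"
      using a by (auto simp: fun_eq_iff field_simps)
    ultimately show ?case by simp
  qed
  obtain n where n: "a ^ n < (y - x) / c"
    using real_arch_pow_inv[of "(y - x) / c" a] a c \<open>x < y\<close> by auto
  define d where "d = a ^ n * c"
  have d: "0 < d" "d < y - x"
    using a c n by (simp_all add: d_def field_simps)
  have nat_multiple: "(\<lambda>x. x + real n * e) \<in> H" if "(\<lambda>x. x + e) \<in> H" for n e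
  proof (induction n)
    case 0
    show ?case using B.one_closed by (simp add: id_def)
  next
    case (Suc n)
    have "(\<lambda>x. x + e) \<circ> (\<lambda>x. x + real n * e) = (\<lambda>x. x + real (Suc n) * e)"
      by (auto simp: fun_eq_iff algebra_simps)
    then show ?case
      using comp_closed[OF that Suc] by simp
  qed
  have d_in: "(\<lambda>x. x + d) \<in> H" "(\<lambda>x. x + - d) \<in> H"
    using small[of n] inv_affine_in[of 1 d] by (simp_all add: d_def)
  define k where "k = \<lfloor>(x - \<xi>) / d\<rfloor> + 1"
  have "(\<lambda>x. x + of_int k * d) \<in> H"
  proof (cases "k \<ge> 0")
    case True
    then show ?thesis
      using nat_multiple[OF d_in(1), of "nat k"] by simp
  next
    case False
    then show ?thesis
      using nat_multiple[OF d_in(2), of "nat (- k)"] by simp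
  qed
  moreover have "(x - \<xi>) / d < of_int k" "of_int k \<le> (x - \<xi>) / d + 1"
    unfolding k_def by linarith+
  then have "x < \<xi> + of_int k * d" "\<xi> + of_int k * d \<le> x + d"
    using d by (simp_all add: field_simps)
  ultimately show ?thesis
    using d by (intro bexI[of _ "\<lambda>x. x + of_int k * d"]) auto
qed

section \<open>The order on lamp configurations\<close>

definition single :: "(real \<Rightarrow> real) \<Rightarrow> (real \<Rightarrow> real) \<Rightarrow> int" where
  "single b = (\<lambda>k. if k = b then 1 else 0)"

lemma single_in_lamps: "b \<in> H \<Longrightarrow> single b \<in> lamps B"
  by (auto simp: B.lamps_iff single_def)

lemma lamps_action_single:
  assumes "b \<in> H" "c \<in> H"
  shows "lamps_action B (r, b) (single c) = (\<lambda>k. r k + single (b \<circ> c) k)"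
proof -
  have "left_reg B b (single c) k = single (b \<circ> c) k" for k
  proof (cases "k \<in> H")
    case True
    have "inv\<^bsub>B\<^esub> b \<circ> k = c \<longleftrightarrow> k = b \<circ> c"
      using inv_apply[OF assms(1)] by (fastforce simp: fun_eq_iff)
    with True show ?thesis
      by (simp add: left_reg_def single_def)
  next
    case False
    then show ?thesis
      using comp_closed[OF assms] by (auto simp: left_reg_def single_def)
  qed
  then show ?thesis
    by (simp add: lamps_action_def)
qed

text \<open>In this lemma and the next, \<open>c\<close> is the largest lamp at which the two configurations differ,
  because \<open>f\<close> and \<open>r\<close> have no lamps at or above the height of \<open>c\<close>; the comparison is between the
  values 0 and 1 there.\<close>

lemma less_single:
  assumes "c \<in> H" and "\<And>k. k \<in> H \<Longrightarrow> c \<xi> \<le> k \<xi> \<Longrightarrow> f k = 0"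
  shows "lamps_less B (orbit_less (\<lambda>b. b) \<xi>) f (single c)"
  unfolding lamps_less_def orbit_less_def
  by (rule bexI[of _ c]) (use assms in \<open>force simp: single_def\<close>)+

lemma single_less:
  assumes "c \<in> H" and "\<And>k. k \<in> H \<Longrightarrow> c \<xi> \<le> k \<xi> \<Longrightarrow> r k = 0" and "d \<xi> < c \<xi>"
  shows "lamps_less B (orbit_less (\<lambda>b. b) \<xi>) (single d) (\<lambda>k. r k + single c k)"
  unfolding lamps_less_def orbit_less_def
  by (rule bexI[of _ c]) (use assms in \<open>force simp: single_def\<close>)+

text \<open>The lamps of the translated configuration are the \<open>k\<close> for which \<open>k\<close> after the translation by
  \<open>n c\<close> is one of the finitely many lamps \<open>s\<close> of \<open>r\<close>. Such a \<open>k\<close> sends \<open>\<xi>\<close> to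
  \<open>s (\<xi> - n c)\<close>, which tends to minus infinity.\<close>

lemma right_reg_translation_vanishes:
  assumes "(\<lambda>x. x + c) \<in> H" "c > 0" and r: "r \<in> lamps B"
  shows "\<forall>\<^sub>F n in sequentially. \<forall>k\<in>H. M \<le> k \<xi> \<longrightarrow> (right_reg B (\<lambda>x. x + c) ^^ n) r k = 0"
proof -
  let ?t = "\<lambda>x. x + c"
  let ?S = "{k. r k \<noteq> 0}"
  have iterate: "(right_reg B ?t ^^ n) r k = r (\<lambda>x. k (x + real n * c))" if "k \<in> H" for n k
    using that
  proof (induction n arbitrary: k)
    case 0
    show ?case by simp
  next
    case (Suc n)
    have "(right_reg B ?t ^^ Suc n) r k = (right_reg B ?t ^^ n) r (k \<circ> ?t)"
      using Suc.prems by (simp add: right_reg_def)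
    also have "\<dots> = r (\<lambda>x. (k \<circ> ?t) (x + real n * c))"
      using comp_closed assms(1) Suc by blast
    also have "(\<lambda>x. (k \<circ> ?t) (x + real n * c)) = (\<lambda>x. k (x + real (Suc n) * c))"
      by (simp add: fun_eq_iff algebra_simps)
    finally show ?case .
  qed
  have "\<forall>\<^sub>F n in sequentially. s (\<xi> - real n * c) < M" if s: "s \<in> H" for s
  proof -
    obtain a b where ab: "a > 0" "s = (\<lambda>x. a * x + b)"
      using affineE[OF s] .
    have "\<forall>\<^sub>F n in sequentially. (a * \<xi> + b - M) / (a * c) < real n"
      using filterlim_real_sequentially unfolding filterlim_at_top_dense by blast
    then show ?thesis
      by eventually_elim (use ab assms(2) in \<open>simp add: field_simps\<close>)
  qed
  moreover have "finite ?S" "?S \<subseteq> H"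
    using r by (auto simp: B.lamps_iff)
  ultimately have "\<forall>\<^sub>F n in sequentially. \<forall>s\<in>?S. s (\<xi> - real n * c) < M"
    by (intro eventually_ball_finite) auto
  then show ?thesis
  proof eventually_elim
    case (elim n)
    show ?case
    proof (intro ballI impI, rule ccontr)
      fix k assume k: "k \<in> H" "M \<le> k \<xi>" "(right_reg B ?t ^^ n) r k \<noteq> 0"
      then have "(\<lambda>x. k (x + real n * c)) \<in> ?S"
        using iterate by simp
      from bspec[OF elim this] show False
        using k by simp
    qed
  qed
qed

end

section \<open>Degeneration to the affine action\<close>

locale wreath_realization = affine_group +
  fixes \<xi> c :: real and \<iota> :: "((real \<Rightarrow> real) \<Rightarrow> int) \<Rightarrow> real"
    and \<psi> :: "((real \<Rightarrow> real) \<Rightarrow> int) \<times> (real \<Rightarrow> real) \<Rightarrow> real \<Rightarrow> real"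
  assumes nonabelian: "\<not> comm_group B"
    and translation: "(\<lambda>x. x + c) \<in> H" "c > 0"
    and \<iota>_image: "\<iota> ` lamps B = \<rat>"
    and \<iota>_mono: "\<And>f g. f \<in> lamps B \<Longrightarrow> g \<in> lamps B \<Longrightarrow>
      lamps_less B (orbit_less (\<lambda>b. b) \<xi>) f g \<Longrightarrow> \<iota> f < \<iota> g"
    and \<psi>_irr: "\<psi> \<in> Hom_irr (wreath B)"
    and \<psi>_\<iota>: "\<And>g f. g \<in> carrier (wreath B) \<Longrightarrow> f \<in> lamps B \<Longrightarrow> \<psi> g (\<iota> f) = \<iota> (lamps_action B g f)"
begin

text \<open>Single lamps are cofinal because every rational number represents a configuration, which is
  finitely supported and hence exceeded by one lamp placed above all of its lamps. They are not
  coinitial: all of them lie above the empty configuration.\<close>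

sublocale cofinal_dense_family H "\<lambda>b. b \<xi>" "\<lambda>b. \<iota> (single b)"
proof
  show dense: "\<exists>b\<in>H. x < b \<xi> \<and> b \<xi> < y" if "x < y" for x y
    using dense_orbit[OF nonabelian translation that] .
  show "\<iota> (single b) < \<iota> (single d)" if "b \<in> H" "d \<in> H" "b \<xi> < d \<xi>" for b d
    by (rule \<iota>_mono) (use that in \<open>auto simp: single_in_lamps intro!: less_single\<close>, auto simp: single_def)
  show "\<exists>b\<in>H. x < \<iota> (single b)" for x
  proof -
    obtain q where "q \<in> \<rat>" "x < q"
      using Rats_dense_in_real[of x "x + 1"] by auto
    then obtain f where f: "f \<in> lamps B" "q = \<iota> f"
      using \<iota>_image by blast
    have "bdd_above ((\<lambda>k. k \<xi>) ` {k. f k \<noteq> 0})"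
      using f by (intro bdd_above_finite finite_imageI) (simp add: B.lamps_iff)
    then obtain z where z: "\<And>k. f k \<noteq> 0 \<Longrightarrow> k \<xi> \<le> z"
      unfolding bdd_above_def by blast
    obtain b where b: "b \<in> H" "z < b \<xi>"
      using dense[of z "z + 1"] by auto
    have "\<iota> f < \<iota> (single b)"
    proof (rule \<iota>_mono[OF f(1) single_in_lamps[OF b(1)] less_single[OF b(1)]])
      show "f k = 0" if "b \<xi> \<le> k \<xi>" for k
        using z[of k] b that by fastforce
    qed
    then show ?thesis
      using b f \<open>x < q\<close> by (intro bexI[of _ b]) auto
  qed
qed

text \<open>The translation in \<open>H\<close> moves every point.\<close>

lemma affine_limit_irr: "(\<lambda>g\<in>carrier (wreath B). snd g) \<in> Hom_irr (wreath B)" (is "?\<phi> \<in> _")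
proof -
  have "?\<phi> \<in> hom (wreath B) Homeo0"
  proof (rule homI)
    fix g assume "g \<in> carrier (wreath B)"
    then show "?\<phi> g \<in> carrier Homeo0"
      using in_Homeo0 by (auto simp: wreath_def)
  next
    fix g h assume gh: "g \<in> carrier (wreath B)" "h \<in> carrier (wreath B)"
    then have "g \<otimes>\<^bsub>wreath B\<^esub> h \<in> carrier (wreath B)"
      by (rule B.wreath_mult_closed)
    moreover have "snd (g \<otimes>\<^bsub>wreath B\<^esub> h) = snd g \<circ> snd h"
      by (simp add: wreath_def split_beta)
    ultimately show "?\<phi> (g \<otimes>\<^bsub>wreath B\<^esub> h) = ?\<phi> g \<otimes>\<^bsub>Homeo0\<^esub> ?\<phi> h"
      using gh by simp
  qed
  moreover have "\<nexists>x. \<forall>g\<in>carrier (wreath B). ?\<phi> g x = x"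
  proof (intro notI, elim exE)
    fix x assume x: "\<forall>g\<in>carrier (wreath B). ?\<phi> g x = x"
    have "((\<lambda>_. 0), (\<lambda>x. x + c)) \<in> carrier (wreath B)"
      using translation by (simp add: wreath_def B.lamps_iff)
    with x have "x + c = x" by force
    then show False using translation by simp
  qed
  ultimately show ?thesis
    by (simp add: Hom_irr_def)
qed

text \<open>The element \<open>(r, b)\<close>, twisted \<open>n\<close> times, sends the single lamp \<open>i\<close> to the single lamp \<open>b i\<close>
  plus the configuration \<open>R n\<close>. Once \<open>R n\<close> has no lamp at or above \<open>M\<close>, it does not affect
  comparisons that are decided at a position above \<open>M\<close>.\<close>

lemma twisted_conjugates_converge:
  assumes s: "\<And>n. s n \<in> carrier Homeo0"
    and near: "\<And>n x. s n x \<le> lev (real n) x + 1 / Suc n"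
      "\<And>n x. - real n < lev (real n) x \<Longrightarrow> lev (real n) x - 1 / Suc n \<le> s n x"
    and g: "g \<in> carrier (wreath B)"
  shows "limitin compact_open_Homeo0
    (\<lambda>n. s n \<circ> \<psi> ((wreath_aut B (\<lambda>x. x + c) ^^ n) g) \<circ> inv\<^bsub>Homeo0\<^esub> (s n)) (snd g) sequentially"
proof -
  let ?\<tau> = "wreath_aut B (\<lambda>x. x + c)"
  obtain r b where g_eq: "g = (r, b)" and r: "r \<in> lamps B" and b: "b \<in> H"
    using g by (auto simp: wreath_def)
  obtain a e where a: "a > 0" and b_eq: "b = (\<lambda>x. a * x + e)"
    using affineE[OF b] .
  define R where "R n = (right_reg B (\<lambda>x. x + c) ^^ n) r" for n
  have \<tau>: "(?\<tau> ^^ n) g = (R n, b)" for n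
    by (simp add: g_eq R_def B.wreath_aut_funpow_apply)
  have in_carrier: "(?\<tau> ^^ n) g \<in> carrier (wreath B)" for n
    using B.wreath_aut_funpow(1)[of "\<lambda>x. x + c" n] translation g by (auto simp: hom_def)
  have vanish: "\<forall>\<^sub>F n in sequentially. \<forall>k\<in>H. M \<le> k \<xi> \<longrightarrow> R n k = 0" for M
    unfolding R_def by (rule right_reg_translation_vanishes[OF translation r])
  define w where "w n i = (\<lambda>k. R n k + single (b \<circ> i) k)" for n i
  have \<psi>_single: "\<psi> ((?\<tau> ^^ n) g) (\<iota> (single i)) = \<iota> (w n i)" if "i \<in> H" for n i
    using \<psi>_\<iota>[OF in_carrier single_in_lamps[OF that]] lamps_action_single[OF b that]
    by (simp add: \<tau> w_def)
  have w: "w n i \<in> lamps B" if i: "i \<in> H" for n i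
  proof -
    have "R n \<in> lamps B"
      using in_carrier[of n] by (simp add: \<tau> wreath_def)
    moreover have "{k. w n i k \<noteq> 0} \<subseteq> insert (b \<circ> i) {k. R n k \<noteq> 0}"
      by (auto simp: w_def single_def)
    moreover have "finite (insert (b \<circ> i) {k. R n k \<noteq> 0})"
      using \<open>R n \<in> lamps B\<close> by (simp add: B.lamps_iff)
    ultimately have "finite {k. w n i k \<noteq> 0}"
      using finite_subset by blast
    moreover have "w n i k = 0" if "k \<notin> H" for k
      using that \<open>R n \<in> lamps B\<close> comp_closed[OF b i]
      by (auto simp: B.lamps_iff w_def single_def)
    ultimately show ?thesis
      by (simp add: B.lamps_iff)
  qed
  have "limitin compact_open_Homeo0
    (\<lambda>n. s n \<circ> \<psi> ((?\<tau> ^^ n) g) \<circ> inv\<^bsub>Homeo0\<^esub> (s n)) (\<lambda>x. a * x + e) sequentially"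
  proof (rule conjugates_converge[OF s near _ a])
    show "\<psi> ((?\<tau> ^^ n) g) \<in> carrier Homeo0" for n
      using \<psi>_irr in_carrier by (auto simp: Hom_irr_def hom_def)
    show "\<forall>\<^sub>F n in sequentially. \<forall>i\<in>H. \<forall>k\<in>H. M < a * i \<xi> + e \<longrightarrow> k \<xi> < a * i \<xi> + e \<longrightarrow>
        \<iota> (single k) < \<psi> ((?\<tau> ^^ n) g) (\<iota> (single i))" for M
      using vanish[of M]
    proof eventually_elim
      case (elim n)
      show ?case
      proof (intro ballI impI)
        fix i k assume i: "i \<in> H" and k: "k \<in> H" and less: "M < a * i \<xi> + e" "k \<xi> < a * i \<xi> + e"
        have "lamps_less B (orbit_less (\<lambda>b. b) \<xi>) (single k) (w n i)"
          unfolding w_def using elim less comp_closed[OF b i]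
          by (intro single_less) (auto simp: b_eq)
        then show "\<iota> (single k) < \<psi> ((?\<tau> ^^ n) g) (\<iota> (single i))"
          using \<iota>_mono single_in_lamps w i k by (simp add: \<psi>_single)
      qed
    qed
    show "\<forall>\<^sub>F n in sequentially. \<forall>i\<in>H. \<forall>k\<in>H. M < k \<xi> \<longrightarrow> a * i \<xi> + e < k \<xi> \<longrightarrow>
        \<psi> ((?\<tau> ^^ n) g) (\<iota> (single i)) < \<iota> (single k)" for M
      using vanish[of M]
    proof eventually_elim
      case (elim n)
      show ?case
      proof (intro ballI impI)
        fix i k assume i: "i \<in> H" and k: "k \<in> H" and less: "M < k \<xi>" "a * i \<xi> + e < k \<xi>"
        have "w n i l = 0" if "l \<in> H" "k \<xi> \<le> l \<xi>" for l
          using elim less that by (auto simp: w_def single_def b_eq)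
        then have "lamps_less B (orbit_less (\<lambda>b. b) \<xi>) (w n i) (single k)"
          using k by (intro less_single) auto
        then show "\<psi> ((?\<tau> ^^ n) g) (\<iota> (single i)) < \<iota> (single k)"
          using \<iota>_mono single_in_lamps w i k by (simp add: \<psi>_single)
      qed
    qed
  qed
  then show ?thesis
    by (simp add: g_eq b_eq)
qed

end

theorem proposition8p8:
  fixes H :: "(real \<Rightarrow> real) set"
    and \<psi> :: "((real \<Rightarrow> real) \<Rightarrow> int) \<times> (real \<Rightarrow> real) \<Rightarrow> real \<Rightarrow> real"
    and \<xi>\<^sub>0 :: real
    and t :: "real \<Rightarrow> real"
  defines "B \<equiv> Aff\<lparr>carrier := H\<rparr>"
  defines "j \<equiv> (\<lambda>b :: real \<Rightarrow> real. b)"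
  defines "G \<equiv> wreath B"
  defines "\<psi>\<^sub>n \<equiv> (\<lambda>n :: nat. compose (carrier G) \<psi> (wreath_aut B t ^^ n))"
  assumes "subgroup H Aff"
    and "finitely_generated_group B"
    and "\<not> comm_group B"
    and "\<forall>b\<in>carrier B. j b \<xi>\<^sub>0 = \<xi>\<^sub>0 \<longrightarrow> b = \<one>\<^bsub>B\<^esub>"
    and "dynamical_realization G (lamps B) (lamps_less B (orbit_less j \<xi>\<^sub>0)) (lamps_action B) \<psi>"
    and "t \<in> carrier B"
    and "\<exists>c>0. j t = (\<lambda>x. x + c)"
  shows "\<exists>s :: nat \<Rightarrow> real \<Rightarrow> real. (\<forall>n. s n \<in> carrier Homeo0) \<and>
           (\<exists>(r :: nat \<Rightarrow> nat) \<phi>. strict_mono r \<and> \<phi> \<in> Hom_irr G \<and>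
              limitin (Hom_irr_topology G)
                ((\<lambda>n. conj_action G (s n) (\<psi>\<^sub>n n)) \<circ> r) \<phi> sequentially \<and>
              positively_conjugate G \<phi> (j \<circ> snd))"
proof -
  obtain c where c: "c > 0" "t = (\<lambda>x. x + c)"
    using assms(11) by (auto simp: j_def)
  obtain \<iota> where \<iota>: "bij_betw \<iota> (lamps B) (\<rat> :: real set)"
      "\<And>x y. x \<in> lamps B \<Longrightarrow> y \<in> lamps B \<Longrightarrow> lamps_less B (orbit_less j \<xi>\<^sub>0) x y \<longleftrightarrow> \<iota> x < \<iota> y"
      "\<And>g x. g \<in> carrier G \<Longrightarrow> x \<in> lamps B \<Longrightarrow> \<psi> g (\<iota> x) = \<iota> (lamps_action B g x)"
    and \<psi>: "\<psi> \<in> Hom_irr G"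
    using assms(9) unfolding dynamical_realization_def by blast
  have t: "t \<in> H"
    using assms(10) by (simp add: B_def)
  interpret wreath_realization H B \<xi>\<^sub>0 c \<iota> \<psi>
  proof (intro wreath_realization.intro affine_group.intro wreath_realization_axioms.intro,
      fold B_def)
    show "H \<subseteq> carrier Aff"
      using assms(5) by (simp add: subgroup_def)
    show "group B"
      using assms(6) by (simp add: finitely_generated_group_def)
    show "\<iota> ` lamps B = \<rat>"
      using \<iota>(1) by (simp add: bij_betw_def)
  qed (use \<iota>(2,3) \<psi> assms(7) t c in \<open>simp_all add: j_def G_def\<close>)
  have "\<forall>n. \<exists>s. s \<in> carrier Homeo0 \<and> (\<forall>x. s x \<le> lev (real n) x + 1 / Suc n \<and>
      (- real n < lev (real n) x \<longrightarrow> lev (real n) x - 1 / Suc n \<le> s x))"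
    using homeomorphism_near_level[of "1 / real (Suc n)" for n] by (simp add: Bex_def)
  then obtain s where s: "\<And>n. s n \<in> carrier Homeo0"
    "\<And>n x. s n x \<le> lev (real n) x + 1 / Suc n"
    "\<And>n x. - real n < lev (real n) x \<Longrightarrow> lev (real n) x - 1 / Suc n \<le> s n x"
    by metis
  define \<phi> where "\<phi> = (\<lambda>g\<in>carrier G. snd g)"
  have \<phi>: "\<phi> \<in> Hom_irr G"
    using affine_limit_irr by (simp add: \<phi>_def G_def)
  have closed: "g \<otimes>\<^bsub>G\<^esub> h \<in> carrier G" if "g \<in> carrier G" "h \<in> carrier G" for g h
    using B.wreath_mult_closed that by (simp add: G_def)
  have "\<psi>\<^sub>n n \<in> Hom_irr G" for n
    unfolding \<psi>\<^sub>n_def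
    using Hom_irr_compose[OF closed \<psi>] B.wreath_aut_funpow[of t] t by (simp add: G_def)
  then have conj_irr: "conj_action G (s n) (\<psi>\<^sub>n n) \<in> Hom_irr G" for n
    by (intro Hom_irr_conj_action closed s)
  have "limitin (Hom_irr_topology G) (\<lambda>n. conj_action G (s n) (\<psi>\<^sub>n n)) \<phi> sequentially"
  proof (rule limitin_Hom_irr[OF \<phi> conj_irr])
    fix g assume g: "g \<in> carrier G"
    then show "limitin compact_open_Homeo0 (\<lambda>n. conj_action G (s n) (\<psi>\<^sub>n n) g) (\<phi> g) sequentially"
      using twisted_conjugates_converge[OF s, of g]
      by (simp add: conj_action_def \<psi>\<^sub>n_def compose_def \<phi>_def c(2) G_def)
  qed
  \<comment> \<open>No passage to a subsequence and no further conjugation takes place.\<close>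
  then have "limitin (Hom_irr_topology G) ((\<lambda>n. conj_action G (s n) (\<psi>\<^sub>n n)) \<circ> id) \<phi> sequentially"
    by simp
  moreover have "positively_conjugate G \<phi> (j \<circ> snd)"
    unfolding positively_conjugate_def
  proof (intro bexI ballI)
    show "id \<circ> \<phi> g = (j \<circ> snd) g \<circ> id" if "g \<in> carrier G" for g
      using that by (simp add: \<phi>_def j_def)
    show "id \<in> carrier Homeo0"
      using monoid.one_closed[OF group.is_monoid[OF group_Homeo0]] by simp
  qed
  ultimately show ?thesis
    using s(1) \<phi> strict_mono_id by blast
qed

end
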